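(* Let $\ell>0$ and let $\mathcal{V}$ be an equilateral closed space polygon without self-intersections, all of whose edges have length $\ell$. Then $$\mathrm{Thi}_p(\mathcal{V})\ge 1 \iff \mathrm{CThi}(\ell,\mathcal{V})\ge 1 .$$
   Context: A closed space polygon $\mathcal{V}$ (possibly with several components) has vertices $v_1,\dots,v_V\in\mathbb{R}^3$ and edges $e_1,\dots,e_V$, where $e_{i-1},e_i$ are the edges meeting at $v_i$ (indices cyclic on each component). $\theta_i$ denotes the turning angle at $v_i$ (exterior angle between the unit tangents of $e_{i-1}$ and $e_i$). $\mathrm{MinRad}(v_i)=\min\{\mathrm{MinRad}^-(v_i),\mathrm{MinRad}^+(v_i)\}$ with $\mathrm{MinRad}^-(v_i)=\frac{|e_{i-1}|}{2\tan(\theta_i/2)}$ and $\mathrm{MinRad}^+(v_i)=\frac{|e_i|}{2\tan(\theta_i/2)}$; vertices with $\theta_i=0$, where these are undefined (infinite), are ignored in minima. For points $p,q$ on $\mathcal{V}$, $d(p,q)=\|p-q\|$. $\mathrm{dcsd}(\mathcal{V})$ is the set of pairs $(p,q)\in\mathcal{V}\times\mathcal{V}$ with $p\ne q$ which are local minima of the self-distance function $d$ on $\mathcal{V}\times\mathcal{V}$. The polygonal thickness of a polygon without self-intersections is $$\mathrm{Thi}_p(\mathcal{V})=\min\Big\{\min_i \mathrm{MinRad}(v_i),\ \min_{(p,q)\in\mathrm{dcsd}(\mathcal{V})}\tfrac{d(p,q)}{2}\Big\}.$$ For $\tau,\ell>0$ let $\theta(\tau,\ell)=2\arctan(\ell/(2\tau))$,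 the turning angle between two edges of length $\ell$ for which $\mathrm{MinRad}=\tau$. Let $\mathrm{vb}(p,q)$ be $\infty$ if $p,q$ lie on different components of $\mathcal{V}$, and otherwise the smaller (over the two arcs joining $p$ and $q$) of the number of vertices between $p$ and $q$, counting $p$ and/or $q$ if they are vertices. Set $\mathrm{VB}(\tau,\ell)=\{(p,q)\in\mathcal{V}\times\mathcal{V}: \mathrm{vb}(p,q)\ge \pi/\theta(\tau,\ell)\}$. The constraint thickness is $$\mathrm{CThi}(\ell,\mathcal{V})=\min\Big\{\min_i \mathrm{MinRad}(v_i),\ \min_{(p,q)\in \mathrm{VB}(1,\ell)}\tfrac{d(p,q)}{2}\Big\}.$$ *)

theory Defs
  imports "HOL-Analysis.Analysis"
begin

text \<open>
  A closed polygon is given by the list of its components, each of which is the cyclic list of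
  its vertices. Vertex positions on a component are integers, read modulo its length;
  \<open>edge_vec c i\<close> is the edge from vertex \<open>i\<close> to vertex \<open>i + 1\<close>.
\<close>

type_synonym component = "(real ^ 3) list"
type_synonym polygon = "component list"

definition vertex :: "component \<Rightarrow> int \<Rightarrow> real ^ 3" where
  "vertex c i = c ! nat (i mod int (length c))"

definition edge_vec :: "component \<Rightarrow> int \<Rightarrow> real ^ 3" where
  "edge_vec c i = vertex c (i + 1) - vertex c i"

text \<open>
  The periodic piecewise linear parametrization (period \<open>length c\<close>) with
  \<open>point c (real_of_int i) = vertex c i\<close>.
\<close>

definition point :: "component \<Rightarrow> real \<Rightarrow> real ^ 3" where
  "point c t = vertex c \<lfloor>t\<rfloor> + frac t *\<^sub>R edge_vec c \<lfloor>t\<rfloor>"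

definition trace_comp :: "component \<Rightarrow> (real ^ 3) set" where
  "trace_comp c = range (point c)"

definition trace :: "polygon \<Rightarrow> (real ^ 3) set" where
  "trace P = (\<Union>c\<in>set P. trace_comp c)"

definition vertices :: "polygon \<Rightarrow> (real ^ 3) set" where
  "vertices P = (\<Union>c\<in>set P. set c)"

definition closed_polygon :: "polygon \<Rightarrow> bool" where
  "closed_polygon P \<longleftrightarrow> P \<noteq> [] \<and> (\<forall>c\<in>set P. 3 \<le> length c)"

definition no_self_intersections :: "polygon \<Rightarrow> bool" where
  "no_self_intersections P \<longleftrightarrow>
     (\<forall>c\<in>set P. inj_on (point c) {0..<real (length c)}) \<and>
     (\<forall>i<length P. \<forall>j<length P. i \<noteq> j \<longrightarrow> trace_comp (P ! i) \<inter> trace_comp (P ! j) = {})"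

definition equilateral :: "real \<Rightarrow> polygon \<Rightarrow> bool" where
  "equilateral l P \<longleftrightarrow> (\<forall>c\<in>set P. \<forall>i. norm (edge_vec c i) = l)"

definition turning_angle :: "component \<Rightarrow> int \<Rightarrow> real" where
  "turning_angle c i = arccos (sgn (edge_vec c (i - 1)) \<bullet> sgn (edge_vec c i))"

definition MinRad_minus :: "component \<Rightarrow> int \<Rightarrow> real" where
  "MinRad_minus c i = norm (edge_vec c (i - 1)) / (2 * tan (turning_angle c i / 2))"

definition MinRad_plus :: "component \<Rightarrow> int \<Rightarrow> real" where
  "MinRad_plus c i = norm (edge_vec c i) / (2 * tan (turning_angle c i / 2))"

definition MinRad :: "component \<Rightarrow> int \<Rightarrow> real" where
  "MinRad c i = min (MinRad_minus c i) (MinRad_plus c i)"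

text \<open>
  Minima are infima in the extended reals, so that the minimum over an empty set is \<open>\<infinity>\<close>
  (for instance, a triangle has no doubly critical pairs). Vertices with turning angle 0,
  where \<open>MinRad\<close> takes the junk value 0, are left out.
\<close>

definition min_MinRad :: "polygon \<Rightarrow> ereal" where
  "min_MinRad P =
     Inf {ereal (MinRad c i) |c i. c \<in> set P \<and> 0 \<le> i \<and> i < int (length c) \<and> turning_angle c i \<noteq> 0}"

definition dcsd :: "polygon \<Rightarrow> ((real ^ 3) \<times> (real ^ 3)) set" where
  "dcsd P = {(p, q) \<in> trace P \<times> trace P. p \<noteq> q \<and>
     (\<forall>\<^sub>F z in at (p, q) within trace P \<times> trace P. dist p q \<le> dist (fst z) (snd z))}"

definition Thi_p :: "polygon \<Rightarrow> ereal" where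
  "Thi_p P = min (min_MinRad P) (INF (p, q)\<in>dcsd P. ereal (dist p q / 2))"

definition theta :: "real \<Rightarrow> real \<Rightarrow> real" where
  "theta \<tau> l = 2 * arctan (l / (2 * \<tau>))"

text \<open>
  For distinct points of one component of a polygon without self-intersections there are exactly
  two such arcs; for \<open>p = q\<close> they are the point itself and the whole component; for points of
  different components there are none.
\<close>

definition arcs_joining :: "polygon \<Rightarrow> real ^ 3 \<Rightarrow> real ^ 3 \<Rightarrow> (real ^ 3) set set" where
  "arcs_joining P p q = {point c ` {s..t} |c s t.
     c \<in> set P \<and> s \<le> t \<and> t \<le> s + real (length c) \<and>
     (point c s = p \<and> point c t = q \<or> point c s = q \<and> point c t = p)}"

definition vb :: "polygon \<Rightarrow> real ^ 3 \<Rightarrow> real ^ 3 \<Rightarrow> ereal" where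
  "vb P p q =
     (if \<exists>c\<in>set P. p \<in> trace_comp c \<and> q \<in> trace_comp c
      then INF A\<in>arcs_joining P p q. ereal (real (card (vertices P \<inter> A)))
      else \<infinity>)"

definition VB :: "polygon \<Rightarrow> real \<Rightarrow> real \<Rightarrow> ((real ^ 3) \<times> (real ^ 3)) set" where
  "VB P \<tau> l = {(p, q) \<in> trace P \<times> trace P. vb P p q \<ge> ereal (pi / theta \<tau> l)}"

definition CThi :: "real \<Rightarrow> polygon \<Rightarrow> ereal" where
  "CThi l P = min (min_MinRad P) (INF (p, q)\<in>VB P 1 l. ereal (dist p q / 2))"

end

theory Submission
  imports Defs
begin

text \<open>
  Both thicknesses contain the minimum of \<open>MinRad\<close>. If this is at least 1, then every turning angle
  is at most \<open>\<theta> = theta 1 l\<close>, and what remains is to compare the pairs in \<open>dcsd P\<close> with those in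
  \<open>VB P 1 l\<close>.

  Every doubly critical pair lies in \<open>VB P 1 l\<close>. At a local minimum of the distance both ends of an
  arc joining the two points make an angle of at least \<open>pi / 2\<close> with the chord. By Fenchel's theorem
  such an arc turns by at least \<open>pi\<close> (lemma \<open>turning_at_least_pi\<close>), and since no vertex
  contributes more than \<open>\<theta>\<close>, it has at least \<open>pi / \<theta>\<close> vertices (\<open>dcsd_subset_VB\<close>). Hence a lower
  bound for the distances on \<open>VB P 1 l\<close> is one for the distances on \<open>dcsd P\<close>.

  For the converse suppose that all doubly critical pairs have distance at least 2, and consider
  a pair in \<open>VB P 1 l\<close> with minimal distance. If the two points lie on different components, or if
  all nearby pairs belong to \<open>VB P 1 l\<close> as well, then the pair is a local minimum of the distance,
  hence doubly critical. Otherwise it is on the boundary of \<open>VB P 1 l\<close>. Then one point is a vertex,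
  and on an arc from it the other point lies on the edge after exactly \<open>k\<close> full edges, where \<open>k + 1\<close>
  is \<open>pi / \<theta>\<close> rounded up. Such an arc is compared, as in Schur's theorem, with the
  planar polygonal arc of the same edge length and constant turning angle \<open>\<theta>\<close>, which is
  circumscribed about the unit circle: there a vertex and an edge that is \<open>k\<close> edges away are on opposite sides of the circle and
  have distance at least 2 (\<open>bounded_turning_chord_ge_2\<close>, \<open>far_pair_dist_ge_2\<close>).

  Both theorems rest on the same elementary fact about the path of unit edge directions on the
  sphere: it has a point at every intermediate time whose angles to all edge directions are
  controlled (\<open>tangent_path_point\<close>).
\<close>

section \<open>Spherical geometry of unit vectors\<close>

lemma arccos_inner_bounds:
  fixes a b :: "'a::real_inner"
  assumes "norm a = 1" "norm b = 1"
  shows "-1 \<le> a \<bullet> b" "a \<bullet> b \<le> 1"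
  using Cauchy_Schwarz_ineq2[of a b] assms by auto

lemma cos_le_of_arccos_le:
  assumes "-1 \<le> x" "x \<le> 1" "arccos x \<le> y" "y \<le> pi"
  shows "cos y \<le> x"
proof -
  have "cos y \<le> cos (arccos x)"
    using assms by (intro cos_monotone_0_pi_le arccos_lbound) auto
  then show ?thesis using assms by simp
qed

text \<open>
  Removing from \<open>a\<close> and \<open>c\<close> their components along \<open>b\<close> leaves orthogonal parts whose lengths are
  the sines of the two angles on the right. The Cauchy-Schwarz inequality for these parts says
  that \<open>a \<bullet> c\<close> is at least the cosine of the sum of the two angles, and \<open>arccos\<close> decreases.
\<close>

lemma arccos_inner_triangle:
  fixes a b c :: "'a::real_inner"
  assumes "norm a = 1" "norm b = 1" "norm c = 1"
  shows "arccos (a \<bullet> c) \<le> arccos (a \<bullet> b) + arccos (b \<bullet> c)"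
proof (cases "arccos (a \<bullet> b) + arccos (b \<bullet> c) \<le> pi")
  case True
  note ab = arccos_inner_bounds[OF assms(1,2)] and bc = arccos_inner_bounds[OF assms(2,3)]
    and ac = arccos_inner_bounds[OF assms(1,3)]
  have sq: "a \<bullet> a = 1" "b \<bullet> b = 1" "c \<bullet> c = 1"
    using assms by (simp_all add: norm_eq_1)
  define x where "x = a - (a \<bullet> b) *\<^sub>R b"
  define y where "y = c - (b \<bullet> c) *\<^sub>R b"
  have nx: "norm x = sin (arccos (a \<bullet> b))"
    unfolding x_def norm_eq_sqrt_inner using ab sq
    by (simp add: sin_arccos inner_diff_left inner_diff_right power2_eq_square inner_commute)
  have ny: "norm y = sin (arccos (b \<bullet> c))"
    unfolding y_def norm_eq_sqrt_inner using bc sq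
    by (simp add: sin_arccos inner_diff_left inner_diff_right power2_eq_square inner_commute)
  have "x \<bullet> y = a \<bullet> c - (a \<bullet> b) * (b \<bullet> c)"
    unfolding x_def y_def using sq
    by (simp add: inner_diff_left inner_diff_right inner_commute)
  moreover have "- (norm x * norm y) \<le> x \<bullet> y"
    using Cauchy_Schwarz_ineq2[of x y] by linarith
  ultimately have "cos (arccos (a \<bullet> b) + arccos (b \<bullet> c)) \<le> a \<bullet> c"
    using ab bc nx ny by (simp add: cos_add)
  then have "arccos (a \<bullet> c) \<le> arccos (cos (arccos (a \<bullet> b) + arccos (b \<bullet> c)))"
    using ac by (intro arccos_le_arccos) auto
  also have "\<dots> = arccos (a \<bullet> b) + arccos (b \<bullet> c)"
    using True ab bc by (intro arccos_cos) (auto intro!: add_nonneg_nonneg arccos_lbound)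
  finally show ?thesis .
next
  case False
  then show ?thesis
    using arccos_ubound[of "a \<bullet> c"] arccos_inner_bounds[OF assms(1,3)] by linarith
qed

text \<open>
  The point that divides the great circle arc from \<open>a\<close> to \<open>b\<close> in the ratio \<open>r : 1 - r\<close>, given by
  spherical linear interpolation.
\<close>

lemma slerp:
  fixes a b :: "'a::real_inner"
  assumes "norm a = 1" "norm b = 1" "0 \<le> r" "r \<le> 1" "arccos (a \<bullet> b) < pi"
  obtains x where "norm x = 1" "arccos (a \<bullet> x) = r * arccos (a \<bullet> b)"
    "arccos (x \<bullet> b) = (1 - r) * arccos (a \<bullet> b)"
proof -
  note ab = arccos_inner_bounds[OF assms(1,2)]
  have sq: "a \<bullet> a = 1" "b \<bullet> b = 1"
    using assms by (simp_all add: norm_eq_1)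
  define \<psi> where "\<psi> = arccos (a \<bullet> b)"
  have cos\<psi>: "a \<bullet> b = cos \<psi>" and \<psi>: "0 \<le> \<psi>" "\<psi> < pi"
    using ab assms(5) by (auto simp: \<psi>_def intro: arccos_lbound)
  show thesis
  proof (cases "\<psi> = 0")
    case True
    have "a \<bullet> b = 1" using cos\<psi> True by simp
    moreover have "arccos (a \<bullet> b) = 0" using True by (simp add: \<psi>_def)
    ultimately show ?thesis using that[of a] assms(1) sq by simp
  next
    case False
    then have s: "sin \<psi> > 0" using \<psi> by (intro sin_gt_zero) auto
    define A where "A = (1 - r) * \<psi>"
    define B where "B = r * \<psi>"
    have AB: "\<psi> = A + B" by (simp add: A_def B_def algebra_simps)
    have bd: "0 \<le> A" "0 \<le> B" using assms \<psi> by (simp_all add: A_def B_def)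
    have sAB: "sin A * cos B + cos A * sin B = sin \<psi>" by (simp add: AB sin_add)
    have cAB: "cos A * cos B - sin A * sin B = cos \<psi>" by (simp add: AB cos_add)
    have qA: "sin A * sin A + cos A * cos A = 1" and qB: "sin B * sin B + cos B * cos B = 1"
      using sin_cos_squared_add3[of A] sin_cos_squared_add3[of B] by linarith+
    define x where "x = (1 / sin \<psi>) *\<^sub>R (sin A *\<^sub>R a + sin B *\<^sub>R b)"
    have "sin A + sin B * cos \<psi> = cos B * sin \<psi>"
      using qB unfolding sAB[symmetric] cAB[symmetric] by algebra
    then have ax: "a \<bullet> x = cos B"
      using s sq cos\<psi> by (simp add: x_def inner_add_right field_simps)
    have "sin A * cos \<psi> + sin B = cos A * sin \<psi>"
      using qA unfolding sAB[symmetric] cAB[symmetric] by algebra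
    then have xb: "x \<bullet> b = cos A"
      using s sq cos\<psi> by (simp add: x_def inner_add_left field_simps)
    have "x \<bullet> x = (1 / sin \<psi>) * (sin A * (a \<bullet> x) + sin B * (x \<bullet> b))"
      by (subst x_def) (simp add: inner_add_left inner_add_right inner_commute)
    also have "\<dots> = 1" using ax xb sAB s by (simp add: field_simps)
    finally have "norm x = 1" by (simp add: norm_eq_1)
    moreover have "arccos (a \<bullet> x) = B" "arccos (x \<bullet> b) = A"
      unfolding ax xb using bd AB \<psi> by (auto intro!: arccos_cos)
    ultimately show ?thesis using that[of x] unfolding A_def B_def \<psi>_def by blast
  qed
qed

lemma arccos_inner_chain:
  fixes U :: "nat \<Rightarrow> 'a::real_inner"
  assumes "\<And>i. norm (U i) = 1" "\<And>i. arccos (U i \<bullet> U (Suc i)) \<le> \<theta>"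
  shows "arccos (U i \<bullet> U (i + d)) \<le> real d * \<theta>"
proof (induction d)
  case 0
  have "U i \<bullet> U i = 1" using assms(1) by (simp add: norm_eq_1)
  then show ?case by simp
next
  case (Suc d)
  have "arccos (U i \<bullet> U (i + Suc d)) \<le> arccos (U i \<bullet> U (i + d)) + arccos (U (i + d) \<bullet> U (Suc (i + d)))"
    using assms(1) arccos_inner_triangle[of "U i" "U (i + d)" "U (Suc (i + d))"] by simp
  also have "\<dots> \<le> real d * \<theta> + \<theta>"
    using Suc assms(2) by (intro add_mono)
  finally show ?case by (simp add: algebra_simps)
qed

text \<open>
  The edge directions \<open>U 0, U 1, \<dots>\<close> of a polygon are joined by great circle arcs to form its
  tangent indicatrix, a path on the sphere. If one arc is traversed per unit of time, no arc being
  longer than \<open>\<theta>\<close>, then \<open>B\<close> is the position at the real time \<open>r\<close>. Both estimates for chords below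
  are obtained by projecting the chord to a suitable direction built from such a point.
\<close>

lemma tangent_path_point:
  fixes U :: "nat \<Rightarrow> 'a::real_inner"
  assumes unit: "\<And>i. norm (U i) = 1" and turn: "\<And>i. arccos (U i \<bullet> U (Suc i)) \<le> \<theta>"
    and "\<theta> < pi" "0 \<le> r"
  obtains B where "norm B = 1" "\<And>i. arccos (U i \<bullet> B) \<le> \<bar>real i - r\<bar> * \<theta>"
proof -
  define j where "j = nat \<lfloor>r\<rfloor>"
  have j: "real j \<le> r" "r < real j + 1" using \<open>0 \<le> r\<close> by (simp_all add: j_def)
  define \<psi> where "\<psi> = arccos (U j \<bullet> U (Suc j))"
  have \<psi>: "\<psi> \<le> \<theta>" "\<psi> < pi" using turn[of j] \<open>\<theta> < pi\<close> by (simp_all add: \<psi>_def)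
  obtain B where B: "norm B = 1" "arccos (U j \<bullet> B) = (r - j) * \<psi>"
    "arccos (B \<bullet> U (Suc j)) = (1 - (r - j)) * \<psi>"
    using slerp[of "U j" "U (Suc j)" "r - j"] unit j \<psi> unfolding \<psi>_def by auto
  have "arccos (U i \<bullet> B) \<le> \<bar>real i - r\<bar> * \<theta>" for i
  proof (cases "i \<le> j")
    case True
    have "arccos (U i \<bullet> B) \<le> arccos (U i \<bullet> U j) + arccos (U j \<bullet> B)"
      using unit B(1) by (intro arccos_inner_triangle)
    also have "\<dots> \<le> real (j - i) * \<theta> + (r - j) * \<theta>"
      using arccos_inner_chain[of U \<theta> i "j - i", OF unit turn] True B(2) j \<psi>
      by (intro add_mono) (auto intro!: mult_left_mono)
    also have "\<dots> = \<bar>real i - r\<bar> * \<theta>"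
      using True j by (simp add: of_nat_diff algebra_simps)
    finally show ?thesis .
  next
    case False
    have "arccos (B \<bullet> U i) \<le> arccos (B \<bullet> U (Suc j)) + arccos (U (Suc j) \<bullet> U i)"
      using unit B(1) by (intro arccos_inner_triangle)
    also have "\<dots> \<le> (1 - (r - j)) * \<theta> + real (i - Suc j) * \<theta>"
      using arccos_inner_chain[of U \<theta> "Suc j" "i - Suc j", OF unit turn] False B(3) j \<psi>
      by (intro add_mono) (auto intro!: mult_left_mono)
    also have "\<dots> = \<bar>real i - r\<bar> * \<theta>"
      using False j by (simp add: of_nat_diff algebra_simps)
    finally show ?thesis by (simp add: inner_commute)
  qed
  then show thesis using that B(1) by blast
qed

lemma arccos_add_less_pi:
  assumes "-1 \<le> x" "x \<le> 1" "-1 \<le> y" "y \<le> 1" "arccos x + arccos y < pi"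
  shows "0 < x + y"
proof (rule ccontr)
  assume "\<not> 0 < x + y"
  then have "arccos (- y) \<le> arccos x"
    using assms by (intro arccos_le_arccos) auto
  then show False using assms arccos_minus[of y] by simp
qed

text \<open>
  This is the case of Fenchel's theorem for an open arc together with its chord \<open>w\<close>, when the
  first and the last edge make angles of at least \<open>pi / 2\<close> with the chord. Close the tangent indicatrix of the
  arc with the direction \<open>v\<close> opposite to the chord: the two steps from and to \<open>v\<close> have length at
  most \<open>pi / 2\<close>, so that a turning below \<open>pi\<close> would give a closed spherical path shorter than
  \<open>2 * pi\<close>. Such a path lies in the open hemisphere around the midpoint of \<open>v\<close> and the point \<open>B\<close>
  halfway along the path. But the edges together with a positive multiple of \<open>v\<close> add up to zero, which is
  impossible for vectors in an open half-space.
\<close>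

lemma turning_at_least_pi:
  fixes U :: "nat \<Rightarrow> 'a::real_inner"
  assumes unit: "\<And>i. norm (U i) = 1" and turn: "\<And>i. arccos (U i \<bullet> U (Suc i)) \<le> \<theta>"
    and \<theta>: "0 \<le> \<theta>" "\<theta> < pi"
    and w: "w = (\<Sum>i\<le>k. a i *\<^sub>R U i)" "\<And>i. 0 \<le> a i" "w \<noteq> 0"
    and ends: "U 0 \<bullet> w \<le> 0" "U k \<bullet> w \<le> 0"
  shows "pi \<le> real k * \<theta>"
proof (rule ccontr)
  assume "\<not> pi \<le> real k * \<theta>"
  then have k: "real k * \<theta> < pi" by simp
  obtain B where B: "norm B = 1" "\<And>i. arccos (U i \<bullet> B) \<le> \<bar>real i - real k / 2\<bar> * \<theta>"
    using tangent_path_point[of U \<theta>, OF unit turn \<theta>(2), of "real k / 2"] by auto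
  define v where "v = - sgn w"
  have v: "norm v = 1" using w(3) by (simp add: v_def norm_sgn)
  have end_angle: "arccos (U i \<bullet> v) \<le> pi / 2" if "U i \<bullet> w \<le> 0" for i
  proof -
    have "0 \<le> U i \<bullet> v" using that
      by (simp add: v_def sgn_div_norm mult_nonneg_nonpos)
    then have "arccos (U i \<bullet> v) \<le> arccos 0"
      using arccos_inner_bounds[OF unit v] by (intro arccos_le_arccos) auto
    then show ?thesis by simp
  qed
  have pos: "0 < U i \<bullet> (B + v)" if "i \<le> k" for i
  proof -
    have "arccos (U i \<bullet> v) + arccos (U i \<bullet> B) \<le> pi / 2 + real k * \<theta> / 2"
    proof (cases "real i \<le> real k / 2")
      case True
      have "arccos (U i \<bullet> v) \<le> arccos (U i \<bullet> U 0) + arccos (U 0 \<bullet> v)"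
        using unit v by (intro arccos_inner_triangle)
      also have "\<dots> \<le> real i * \<theta> + pi / 2"
        using arccos_inner_chain[of U \<theta> 0 i, OF unit turn] end_angle[OF ends(1)]
        by (simp add: inner_commute)
      finally show ?thesis using B(2)[of i] True by (simp add: algebra_simps)
    next
      case False
      have "arccos (U i \<bullet> v) \<le> arccos (U i \<bullet> U k) + arccos (U k \<bullet> v)"
        using unit v by (intro arccos_inner_triangle)
      also have "\<dots> \<le> real (k - i) * \<theta> + pi / 2"
        using arccos_inner_chain[of U \<theta> i "k - i", OF unit turn] end_angle[OF ends(2)] that
        by simp
      finally show ?thesis using B(2)[of i] False that by (simp add: of_nat_diff algebra_simps)
    qed
    then have "arccos (U i \<bullet> v) + arccos (U i \<bullet> B) < pi" using k by linarith
    then have "0 < U i \<bullet> v + U i \<bullet> B"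
      using arccos_inner_bounds[OF unit v] arccos_inner_bounds[OF unit B(1)]
      by (intro arccos_add_less_pi) auto
    then show ?thesis by (simp add: inner_add_right)
  qed
  have "w = norm w *\<^sub>R (- v)" using w(3) by (simp add: v_def sgn_div_norm)
  then have "w \<bullet> (B + v) = norm w * (- (v \<bullet> B) - v \<bullet> v)"
    by (metis inner_add_right inner_minus_left inner_scaleR_left minus_add_distrib diff_conv_add_uminus)
  also have "\<dots> \<le> 0"
    using arccos_inner_bounds[OF v B(1)] v by (intro mult_nonneg_nonpos) (auto simp: norm_eq_1)
  finally have "(\<Sum>i\<le>k. a i * (U i \<bullet> (B + v))) \<le> 0"
    by (simp add: w(1) inner_sum_left)
  moreover have "0 \<le> a i * (U i \<bullet> (B + v))" if "i \<le> k" for i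
    using w(2) pos[OF that] by (simp add: less_imp_le)
  ultimately have "\<forall>i\<in>{..k}. a i * (U i \<bullet> (B + v)) = 0"
    by (subst sum_nonneg_eq_0_iff[symmetric]) (auto intro!: antisym sum_nonneg)
  then have "\<forall>i\<in>{..k}. a i = 0" using pos by fastforce
  then show False using w(1,3) by simp
qed

text \<open>
  The factor \<open>2 * sin (\<theta> / 2)\<close> makes the sum telescope.
\<close>

lemma sum_cos_arithmetic:
  "(\<Sum>i<k. 2 * sin (\<theta> / 2) * cos ((real i - r) * \<theta>)) =
     sin ((real k - r) * \<theta> - \<theta> / 2) + sin (r * \<theta> + \<theta> / 2)"
proof (induction k)
  case 0
  have "sin (- r * \<theta> - \<theta> / 2) = - sin (r * \<theta> + \<theta> / 2)"
    by (metis sin_minus minus_add_distrib mult_minus_left diff_conv_add_uminus)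
  then show ?case by simp
next
  case (Suc k)
  define A where "A = (real k - r) * \<theta>"
  have "(real (Suc k) - r) * \<theta> - \<theta> / 2 = A + \<theta> / 2" by (simp add: A_def field_simps)
  then show ?case using Suc unfolding A_def[symmetric]
    by (simp add: sin_add sin_diff algebra_simps A_def[symmetric])
qed

text \<open>
  This is a case of Schur's comparison theorem. The model is the planar polygonal arc with
  constant turning angle \<open>\<theta>\<close> circumscribed about a circle of radius 1, whose edges have length
  \<open>2 * tan (\<theta> / 2)\<close>.
  There the edge \<open>k\<close> is nearly opposite to the vertex 0, and the whole line through this edge has
  distance at least 2 from that vertex. The chord is projected to the normal of this line, which
  in the model is the tangent direction a quarter turn before edge \<open>k\<close>; in space it is the point
  \<open>B\<close> of the tangent indicatrix at the corresponding time \<open>r\<close>. A polygon that turns no faster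
  than the model has all its edge directions at least as close to \<open>B\<close>, hence a projection at least
  as long. In the model edge \<open>k\<close> is orthogonal to the normal, so the angle between \<open>U k\<close> and
  \<open>B\<close> is at most \<open>pi / 2\<close> and the last piece, whatever its length \<open>x\<close>, does not shorten the
  projection.
\<close>

lemma bounded_turning_chord_ge_2:
  fixes U :: "nat \<Rightarrow> 'a::real_inner"
  assumes unit: "\<And>i. norm (U i) = 1" and turn: "\<And>i. arccos (U i \<bullet> U (Suc i)) \<le> \<theta>"
    and \<theta>: "0 < \<theta>" "\<theta> < pi"
    and k: "real k * \<theta> < pi" "pi \<le> real (Suc k) * \<theta>" and "0 \<le> x"
  shows "2 \<le> norm ((\<Sum>i<k. (2 * tan (\<theta> / 2)) *\<^sub>R U i) + x *\<^sub>R U k)"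
proof -
  define r where "r = real k - pi / (2 * \<theta>)"
  have r\<theta>: "r * \<theta> = real k * \<theta> - pi / 2"
    using \<theta> by (simp add: r_def field_simps)
  have "k \<noteq> 0" using k \<theta> by (cases k) auto
  then have "\<theta> \<le> real k * \<theta>" using \<theta> by simp
  moreover have Sk: "real (Suc k) * \<theta> = real k * \<theta> + \<theta>" by (simp add: algebra_simps)
  ultimately have "0 \<le> r * \<theta>" using k r\<theta> by linarith
  then have "0 \<le> r" using \<theta> by (simp add: zero_le_mult_iff)
  then obtain B where B: "norm B = 1" "\<And>i. arccos (U i \<bullet> B) \<le> \<bar>real i - r\<bar> * \<theta>"
    using tangent_path_point[of U \<theta>, OF unit turn \<theta>(2), of r] by auto
  have inner_ge: "cos ((real i - r) * \<theta>) \<le> U i \<bullet> B" if "i \<le> k" for i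
  proof -
    have "real i * \<theta> \<le> real k * \<theta>" "0 \<le> real i * \<theta>" using that \<theta> by simp_all
    then have "\<bar>(real i - r) * \<theta>\<bar> \<le> pi"
      using r\<theta> k by (simp add: left_diff_distrib abs_le_iff)
    then have "\<bar>real i - r\<bar> * \<theta> \<le> pi" using \<theta> by (simp add: abs_mult)
    then have "cos (\<bar>real i - r\<bar> * \<theta>) \<le> U i \<bullet> B"
      using arccos_inner_bounds[OF unit B(1)] B(2)[of i] by (intro cos_le_of_arccos_le) auto
    moreover have "\<bar>real i - r\<bar> * \<theta> = \<bar>(real i - r) * \<theta>\<bar>" using \<theta> by (simp add: abs_mult)
    ultimately show ?thesis by simp
  qed
  define C where "C = cos (\<theta> / 2)"
  have C: "0 < C" unfolding C_def using \<theta> by (intro cos_gt_zero) auto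
  have t: "0 < tan (\<theta> / 2)" using \<theta> by (intro tan_gt_zero) auto
  have last: "0 \<le> U k \<bullet> B"
    using inner_ge[of k] r\<theta> by (simp add: left_diff_distrib)
  \<comment> \<open>\<open>z\<close> is the angle between the antipode of vertex 0 and the midpoint of edge \<open>k\<close> in the model\<close>
  define z where "z = real k * \<theta> + \<theta> / 2 - pi"
  have "\<bar>z\<bar> \<le> \<theta> / 2" using k Sk unfolding z_def by linarith
  then have "C \<le> cos \<bar>z\<bar>" unfolding C_def using \<theta> by (intro cos_monotone_0_pi_le) auto
  also have "\<dots> = sin (r * \<theta> + \<theta> / 2)"
  proof -
    have "r * \<theta> + \<theta> / 2 = z + pi / 2" using r\<theta> by (simp add: z_def)
    then show ?thesis by (simp add: sin_add)
  qed
  finally have s1: "C \<le> sin (r * \<theta> + \<theta> / 2)" .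
  have s2: "sin ((real k - r) * \<theta> - \<theta> / 2) = C"
    using r\<theta> by (simp add: left_diff_distrib C_def cos_sin_eq)
  have "2 = (C + C) / C" using C by simp
  also have "\<dots> \<le> (\<Sum>i<k. 2 * sin (\<theta> / 2) * cos ((real i - r) * \<theta>)) / C"
    unfolding sum_cos_arithmetic s2 using s1 C by (intro divide_right_mono) auto
  also have "\<dots> = (\<Sum>i<k. 2 * tan (\<theta> / 2) * cos ((real i - r) * \<theta>))"
    by (simp add: sum_divide_distrib tan_def C_def)
  also have "\<dots> \<le> (\<Sum>i<k. 2 * tan (\<theta> / 2) * (U i \<bullet> B)) + x * (U k \<bullet> B)"
    using t last \<open>0 \<le> x\<close> inner_ge by (auto intro!: add_increasing2 sum_mono mult_left_mono)
  also have "\<dots> = ((\<Sum>i<k. (2 * tan (\<theta> / 2)) *\<^sub>R U i) + x *\<^sub>R U k) \<bullet> B"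
    by (simp add: inner_add_left inner_sum_left)
  also have "\<dots> \<le> norm ((\<Sum>i<k. (2 * tan (\<theta> / 2)) *\<^sub>R U i) + x *\<^sub>R U k)"
    using norm_cauchy_schwarz B(1) by (metis mult.right_neutral)
  finally show ?thesis .
qed

section \<open>The periodic parametrization of a component\<close>

lemma vertex_shift: "vertex c (i + k * int (length c)) = vertex c i"
  by (simp add: vertex_def)

lemma edge_vec_shift: "edge_vec c (i + k * int (length c)) = edge_vec c i"
  using vertex_shift[of c "i + 1" k] by (simp add: edge_vec_def vertex_shift algebra_simps)

lemma turning_angle_mod: "turning_angle c (i mod int (length c)) = turning_angle c i"
proof -
  define k where "k = - (i div int (length c))"
  have "i mod int (length c) = i + k * int (length c)"
    by (simp add: k_def minus_div_mult_eq_mod)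
  then show ?thesis
    using edge_vec_shift[of c "i - 1" k] edge_vec_shift[of c i k]
    by (simp add: turning_angle_def algebra_simps)
qed

lemma point_shift: "point c (t + of_int k * real (length c)) = point c t"
proof -
  have e: "t + of_int k * real (length c) = t + of_int (k * int (length c))" by simp
  have f: "frac (t + of_int (k * int (length c))) = frac t"
    by (simp add: frac_def)
  have g: "\<lfloor>t + of_int (k * int (length c))\<rfloor> = \<lfloor>t\<rfloor> + k * int (length c)"
    by (metis add.commute floor_add_int)
  show ?thesis
    unfolding e by (simp only: point_def f g vertex_shift edge_vec_shift)
qed

lemma point_shift_once: "point c (t + real (length c)) = point c t"
  using point_shift[of c t 1] by simp

lemma point_on_edge:
  assumes "of_int a \<le> t" "t \<le> of_int a + 1"
  shows "point c t = vertex c a + (t - of_int a) *\<^sub>R edge_vec c a"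
proof (cases "t = of_int a + 1")
  case True
  then have "t = of_int (a + 1)" by simp
  then have "\<lfloor>t\<rfloor> = a + 1" "frac t = 0" by (simp_all del: of_int_add)
  then show ?thesis using True by (simp add: point_def edge_vec_def)
next
  case False
  then have "\<lfloor>t\<rfloor> = a" using assms by (intro floor_unique) auto
  then show ?thesis by (simp add: point_def frac_def)
qed

lemma point_of_int: "point c (of_int a) = vertex c a"
  by (simp add: point_def)

lemma continuous_on_point: "continuous_on S (point c)"
proof -
  have "isCont (point c) t" for t
  proof -
    define a where "a = \<lfloor>t\<rfloor>"
    have edge: "continuous_on {of_int b..of_int b + 1} (point c)" for b
    proof -
      have "continuous_on {of_int b..of_int b + 1}
          (\<lambda>t. vertex c b + (t - of_int b) *\<^sub>R edge_vec c b)"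
        by (intro continuous_intros)
      then show ?thesis
        by (rule continuous_on_eq) (auto simp: point_on_edge[of b])
    qed
    have "continuous_on ({of_int (a - 1)..of_int (a - 1) + 1} \<union> {of_int a..of_int a + 1}) (point c)"
      by (intro continuous_on_closed_Un edge) auto
    moreover have "{of_int (a - 1)..of_int (a - 1) + 1} \<union> {of_int a..of_int a + 1}
        = {of_int a - 1..of_int a + 1 :: real}"
      by auto
    ultimately have "continuous_on {of_int a - 1..of_int a + 1} (point c)" by simp
    moreover have "of_int a \<le> t" "t < of_int a + 1" by (simp_all add: a_def)
    ultimately show ?thesis
      by (intro continuous_on_interior[of "{of_int a - 1..of_int a + 1}"]) auto
  qed
  then show ?thesis by (simp add: continuous_at_imp_continuous_on)
qed

lemma ex_shift_into_period:
  assumes "c \<noteq> []"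
  obtains k :: int where "a \<le> s + of_int k * real (length c)"
    "s + of_int k * real (length c) < a + real (length c)"
proof -
  have n: "real (length c) > 0" using assms by simp
  define m where "m = \<lfloor>(s - a) / real (length c)\<rfloor>"
  have "of_int m \<le> (s - a) / real (length c)" "(s - a) / real (length c) < of_int m + 1"
    by (simp_all add: m_def)
  then have "of_int m * real (length c) \<le> s - a" "s - a < (of_int m + 1) * real (length c)"
    using n by (simp_all add: field_simps)
  then show thesis using that[of "- m"] by (simp add: algebra_simps)
qed

lemma trace_comp_period:
  assumes "c \<noteq> []" "p \<in> trace_comp c"
  obtains s where "a \<le> s" "s < a + real (length c)" "point c s = p"
proof -
  from assms obtain s where s: "p = point c s" by (auto simp: trace_comp_def)
  obtain k :: int where "a \<le> s + of_int k * real (length c)"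
    "s + of_int k * real (length c) < a + real (length c)"
    using ex_shift_into_period[OF assms(1), of a s] .
  then show thesis using that s point_shift by metis
qed

lemma point_eq_imp_shift:
  assumes "inj_on (point c) {0..<real (length c)}" "c \<noteq> []" "point c s = point c t"
  obtains k :: int where "s = t + of_int k * real (length c)"
proof -
  obtain i :: int where i: "0 \<le> s + of_int i * real (length c)"
    "s + of_int i * real (length c) < 0 + real (length c)"
    using ex_shift_into_period[OF assms(2), of 0 s] .
  obtain j :: int where j: "0 \<le> t + of_int j * real (length c)"
    "t + of_int j * real (length c) < 0 + real (length c)"
    using ex_shift_into_period[OF assms(2), of 0 t] .
  have "point c (s + of_int i * real (length c)) = point c (t + of_int j * real (length c))"
    using assms(3) by (simp add: point_shift)
  then have "s + of_int i * real (length c) = t + of_int j * real (length c)"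
    using i j by (intro inj_onD[OF assms(1)]) auto
  then show thesis using that[of "j - i"] by (simp add: algebra_simps)
qed

lemma inj_on_point_period:
  assumes "inj_on (point c) {0..<real (length c)}" "c \<noteq> []"
    and "point c s = point c t" "\<bar>s - t\<bar> < real (length c)"
  shows "s = t"
proof -
  obtain k :: int where k: "s = t + of_int k * real (length c)"
    using point_eq_imp_shift[OF assms(1-3)] .
  then have "\<bar>of_int k\<bar> * real (length c) < 1 * real (length c)"
    using assms(4) by (simp add: abs_mult)
  then have "\<bar>of_int k :: real\<bar> < 1" by (rule mult_right_less_imp_less) simp
  then have "k = 0" by linarith
  then show ?thesis using k by simp
qed

lemma compact_trace_comp:
  assumes "c \<noteq> []"
  shows "compact (trace_comp c)"
proof -
  have "trace_comp c = point c ` {0..real (length c)}"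
  proof
    show "trace_comp c \<subseteq> point c ` {0..real (length c)}"
    proof
      fix p assume "p \<in> trace_comp c"
      then obtain s where "0 \<le> s" "s < 0 + real (length c)" "point c s = p"
        using trace_comp_period[OF assms, of p 0] by blast
      then show "p \<in> point c ` {0..real (length c)}" by force
    qed
  qed (auto simp: trace_comp_def)
  then show ?thesis
    by (simp add: compact_continuous_image continuous_on_point)
qed

lemma vertex_add_edges:
  "vertex c (a + int k) = vertex c a + (\<Sum>i<k. edge_vec c (a + int i))"
proof (induction k)
  case (Suc k)
  then show ?case by (simp add: edge_vec_def algebra_simps)
qed simp

lemma set_eq_vertices:
  assumes "c \<noteq> []"
  shows "set c = range (vertex c)"
proof
  show "set c \<subseteq> range (vertex c)"
  proof
    fix x assume "x \<in> set c"
    then obtain i where "i < length c" "x = c ! i" by (auto simp: in_set_conv_nth)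
    then have "x = vertex c (int i)" by (simp add: vertex_def)
    then show "x \<in> range (vertex c)" by blast
  qed
  have "nat (i mod int (length c)) < length c" for i
    using assms by (simp add: nat_less_iff)
  then show "range (vertex c) \<subseteq> set c" by (auto simp: vertex_def)
qed

section \<open>Polygons without self-intersections\<close>

lemma components_disjoint:
  assumes "no_self_intersections P" "c \<in> set P" "c' \<in> set P" "c \<noteq> c'"
  shows "trace_comp c \<inter> trace_comp c' = {}"
  using assms unfolding no_self_intersections_def by (metis in_set_conv_nth)

lemma closed_polygon_nonempty: "closed_polygon P \<Longrightarrow> c \<in> set P \<Longrightarrow> c \<noteq> []"
  by (auto simp: closed_polygon_def)

lemma no_self_intersections_inj:
  "no_self_intersections P \<Longrightarrow> c \<in> set P \<Longrightarrow> inj_on (point c) {0..<real (length c)}"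
  by (auto simp: no_self_intersections_def)

lemma set_subset_trace_comp: "c \<noteq> [] \<Longrightarrow> set c \<subseteq> trace_comp c"
  by (auto simp: set_eq_vertices trace_comp_def simp flip: point_of_int)

lemma vertices_on_arc:
  assumes P: "closed_polygon P" "no_self_intersections P" "c \<in> set P"
    and st: "s \<le> t" "t < s + real (length c)"
  shows "vertices P \<inter> point c ` {s..t} = vertex c ` {\<lceil>s\<rceil>..\<lfloor>t\<rfloor>}"
    and "card (vertices P \<inter> point c ` {s..t}) = nat (\<lfloor>t\<rfloor> - \<lceil>s\<rceil> + 1)"
proof -
  note ne = closed_polygon_nonempty[OF P(1,3)] and inj = no_self_intersections_inj[OF P(2,3)]
  show eq: "vertices P \<inter> point c ` {s..t} = vertex c ` {\<lceil>s\<rceil>..\<lfloor>t\<rfloor>}"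
  proof (intro equalityI subsetI)
    fix x assume "x \<in> vertices P \<inter> point c ` {s..t}"
    then obtain c' r where x: "c' \<in> set P" "x \<in> set c'" "x = point c r" "s \<le> r" "r \<le> t"
      by (auto simp: vertices_def)
    have "x \<in> trace_comp c'" using x closed_polygon_nonempty[OF P(1)] set_subset_trace_comp by blast
    then have "c' = c"
      using components_disjoint[OF P(2) x(1) P(3)] x(3) by (auto simp: trace_comp_def)
    then obtain a where "x = vertex c a" using x(2) set_eq_vertices[OF ne] by auto
    then have "point c r = point c (of_int a)" by (simp add: point_of_int x(3))
    then obtain k :: int where "r = of_int a + of_int k * real (length c)"
      using point_eq_imp_shift[OF inj ne] by blast
    then have r: "r = of_int (a + k * int (length c))" by simp
    define b where "b = a + k * int (length c)"
    have "b \<in> {\<lceil>s\<rceil>..\<lfloor>t\<rfloor>}" using x(4,5) r unfolding b_def[symmetric]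
      by (simp add: ceiling_le_iff le_floor_iff)
    moreover have "x = vertex c b" using x(3) r by (metis b_def point_of_int)
    ultimately show "x \<in> vertex c ` {\<lceil>s\<rceil>..\<lfloor>t\<rfloor>}" by blast
  next
    fix x assume "x \<in> vertex c ` {\<lceil>s\<rceil>..\<lfloor>t\<rfloor>}"
    then obtain a where a: "x = vertex c a" "\<lceil>s\<rceil> \<le> a" "a \<le> \<lfloor>t\<rfloor>" by auto
    then have "s \<le> of_int a" "of_int a \<le> t" by (simp_all add: ceiling_le_iff le_floor_iff)
    moreover have "x \<in> vertices P"
      using a(1) P(3) set_eq_vertices[OF ne] by (auto simp: vertices_def)
    ultimately show "x \<in> vertices P \<inter> point c ` {s..t}"
      using a(1) point_of_int by (metis Int_iff atLeastAtMost_iff imageI)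
  qed
  have "inj_on (vertex c) {\<lceil>s\<rceil>..\<lfloor>t\<rfloor>}"
  proof (rule inj_onI)
    fix a b assume ab: "a \<in> {\<lceil>s\<rceil>..\<lfloor>t\<rfloor>}" "b \<in> {\<lceil>s\<rceil>..\<lfloor>t\<rfloor>}" "vertex c a = vertex c b"
    then have "s \<le> of_int a" "of_int a \<le> t" "s \<le> of_int b" "of_int b \<le> t"
      by (simp_all add: ceiling_le_iff le_floor_iff)
    then have "\<bar>of_int a - of_int b :: real\<bar> < real (length c)" using st by linarith
    then have "of_int a = (of_int b :: real)"
      using ab(3) by (intro inj_on_point_period[OF inj ne]) (simp_all add: point_of_int)
    then show "a = b" by simp
  qed
  then show "card (vertices P \<inter> point c ` {s..t}) = nat (\<lfloor>t\<rfloor> - \<lceil>s\<rceil> + 1)"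
    by (simp add: eq card_image)
qed

text \<open>
  A simple closed polygon is homeomorphic to a disjoint union of circles. In the form needed for
  local minima of the distance: the rest of the polygon, outside of a parameter interval around
  \<open>s\<close>, is compact and misses \<open>point c s\<close>, so it stays away from this point.
\<close>

lemma nearby_points_have_nearby_parameters:
  assumes P: "closed_polygon P" "no_self_intersections P" "c \<in> set P" and "0 < e"
  obtains d where "0 < d"
    "\<And>p. p \<in> trace P \<Longrightarrow> dist p (point c s) < d \<Longrightarrow> \<exists>s'. \<bar>s' - s\<bar> < e \<and> point c s' = p"
proof -
  note ne = closed_polygon_nonempty[OF P(1,3)] and inj = no_self_intersections_inj[OF P(2,3)]
  define n where "n = real (length c)"
  have n: "0 < n" using ne by (simp add: n_def)
  define C where "C = point c ` (cball s (n / 2) - ball s e) \<union> (\<Union>c'\<in>set P - {c}. trace_comp c')"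
  have "closed C"
    unfolding C_def
    by (intro closed_Un compact_imp_closed compact_continuous_image continuous_on_point
          compact_diff compact_cball open_ball closed_UN ballI compact_trace_comp)
       (use closed_polygon_nonempty[OF P(1)] in auto)
  moreover have "point c s \<notin> C"
  proof
    assume "point c s \<in> C"
    then consider "point c s \<in> point c ` (cball s (n / 2) - ball s e)"
      | c' where "c' \<in> set P" "c' \<noteq> c" "point c s \<in> trace_comp c'"
      by (auto simp: C_def)
    then show False
    proof cases
      case 1
      then obtain r where r: "point c s = point c r" "r \<in> cball s (n / 2) - ball s e" by (rule imageE)
      then have "\<bar>s - r\<bar> < n" using n by (simp add: dist_real_def)
      then have "s = r" using r(1) by (intro inj_on_point_period[OF inj ne]) (simp_all add: n_def)
      then show False using r \<open>0 < e\<close> by simp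
    next
      case 2
      then show False using components_disjoint[OF P(2) 2(1) P(3)] by (auto simp: trace_comp_def)
    qed
  qed
  ultimately obtain d where d: "0 < d" "ball (point c s) d \<subseteq> - C"
    using open_contains_ball[of "- C"] by (auto simp: open_closed)
  have "\<exists>s'. \<bar>s' - s\<bar> < e \<and> point c s' = p" if p: "p \<in> trace P" "dist p (point c s) < d" for p
  proof -
    have "p \<notin> C" using d(2) p(2) by (auto simp: subset_eq dist_commute)
    then have "p \<in> trace_comp c" using p(1) by (auto simp: trace_def C_def)
    then obtain r where r: "s - n / 2 \<le> r" "r < s - n / 2 + n" "point c r = p"
      using trace_comp_period[OF ne, of p "s - n / 2"] by (auto simp: n_def)
    then have "\<bar>s - r\<bar> \<le> n / 2" by linarith
    then have "r \<in> cball s (n / 2)" by (simp add: dist_real_def)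
    then have "r \<in> ball s e" using r(3) \<open>p \<notin> C\<close> by (auto simp: C_def)
    then show ?thesis using r(3) by (auto simp: dist_real_def abs_minus_commute)
  qed
  then show thesis using that d(1) by blast
qed

section \<open>Doubly critical pairs are far apart along the polygon\<close>

text \<open>
  The next two lemmas describe local minimality with a separate neighbourhood for each of the two
  points instead of a neighbourhood of the pair.
\<close>

lemma dcsd_dist_le:
  assumes "(p, q) \<in> dcsd P"
  obtains d where "0 < d" "\<And>p' q'. p' \<in> trace P \<Longrightarrow> q' \<in> trace P \<Longrightarrow> dist p' p < d \<Longrightarrow> dist q' q < d \<Longrightarrow>
    dist p q \<le> dist p' q'"
proof -
  from assms have "\<forall>\<^sub>F z in at (p, q) within trace P \<times> trace P. dist p q \<le> dist (fst z) (snd z)"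
    by (simp add: dcsd_def)
  then obtain d where d: "0 < d" "\<And>z. z \<in> trace P \<times> trace P \<Longrightarrow> z \<noteq> (p, q) \<Longrightarrow> dist z (p, q) < d \<Longrightarrow>
      dist p q \<le> dist (fst z) (snd z)"
    unfolding eventually_at by blast
  have "dist p q \<le> dist p' q'"
    if *: "p' \<in> trace P" "q' \<in> trace P" "dist p' p < d / 2" "dist q' q < d / 2" for p' q'
  proof (cases "(p', q') = (p, q)")
    case False
    have "dist (p', q') (p, q) \<le> dist p' p + dist q' q"
      by (simp add: dist_Pair_Pair sqrt_sum_squares_le_sum)
    also have "\<dots> < d" using * by simp
    finally show ?thesis using d(2)[of "(p', q')"] * False by simp
  qed simp
  then show thesis using that[of "d / 2"] d(1) by simp
qed

lemma dcsdI:
  assumes "p \<in> trace P" "q \<in> trace P" "p \<noteq> q" "0 < d"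
    and "\<And>p' q'. p' \<in> trace P \<Longrightarrow> q' \<in> trace P \<Longrightarrow> dist p' p < d \<Longrightarrow> dist q' q < d \<Longrightarrow> dist p q \<le> dist p' q'"
  shows "(p, q) \<in> dcsd P"
proof -
  have "\<forall>\<^sub>F z in at (p, q) within trace P \<times> trace P. dist p q \<le> dist (fst z) (snd z)"
    unfolding eventually_at
  proof (intro exI conjI ballI impI)
    fix z assume z: "z \<in> trace P \<times> trace P" "z \<noteq> (p, q) \<and> dist z (p, q) < d"
    show "dist p q \<le> dist (fst z) (snd z)"
    proof (rule assms(5))
      show "dist (fst z) p < d" using dist_fst_le[of z "(p, q)"] z by simp
      show "dist (snd z) q < d" using dist_snd_le[of z "(p, q)"] z by simp
    qed (use z in auto)
  qed fact
  then show ?thesis using assms by (simp add: dcsd_def)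
qed

lemma dcsd_sym:
  assumes pq: "(p, q) \<in> dcsd P"
  shows "(q, p) \<in> dcsd P"
proof -
  obtain d where d: "0 < d" "\<And>p' q'. p' \<in> trace P \<Longrightarrow> q' \<in> trace P \<Longrightarrow> dist p' p < d \<Longrightarrow> dist q' q < d \<Longrightarrow>
    dist p q \<le> dist p' q'" using dcsd_dist_le[OF pq] by blast
  show ?thesis
  proof (rule dcsdI[OF _ _ _ d(1)])
    show "dist q p \<le> dist q' p'"
      if "q' \<in> trace P" "p' \<in> trace P" "dist q' q < d" "dist p' p < d" for q' p'
      using d(2)[of p' q'] that by (simp add: dist_commute)
  qed (use pq in \<open>auto simp: dcsd_def\<close>)
qed

text \<open>
  First variation of the distance at a local minimum: a direction in which \<open>p\<close> can be moved along
  the polygon makes an angle of at least \<open>pi / 2\<close> with the chord towards \<open>q\<close>.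
\<close>

lemma dcsd_first_variation:
  assumes pq: "(p, q) \<in> dcsd P" and "0 < e"
    and v: "\<And>h. 0 < h \<Longrightarrow> h < e \<Longrightarrow> p + h *\<^sub>R v \<in> trace P"
  shows "v \<bullet> (q - p) \<le> 0"
proof (rule ccontr)
  assume "\<not> v \<bullet> (q - p) \<le> 0"
  then have pos: "0 < v \<bullet> (q - p)" by simp
  then have "v \<noteq> 0" by auto
  then have nv: "0 < norm v" by simp
  obtain d where d: "0 < d" "\<And>p' q'. p' \<in> trace P \<Longrightarrow> q' \<in> trace P \<Longrightarrow> dist p' p < d \<Longrightarrow> dist q' q < d \<Longrightarrow>
    dist p q \<le> dist p' q'" using dcsd_dist_le[OF pq] by blast
  define h where "h = min (e / 2) (min (d / (2 * norm v)) (v \<bullet> (q - p) / (v \<bullet> v)))"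
  have h: "0 < h" "h < e" using \<open>0 < e\<close> d(1) nv pos by (auto simp: h_def)
  have "h \<le> d / (2 * norm v)" "h \<le> v \<bullet> (q - p) / (v \<bullet> v)" by (auto simp: h_def)
  then have h': "h * norm v < d" "h * (v \<bullet> v) \<le> v \<bullet> (q - p)"
    using nv d(1) \<open>v \<noteq> 0\<close> by (simp_all add: field_simps)
  have "dist p q \<le> dist (p + h *\<^sub>R v) q"
    using pq h h' d(1) by (intro d(2) v) (auto simp: dcsd_def dist_norm)
  then have "(norm (q - p))\<^sup>2 \<le> (norm ((q - p) - h *\<^sub>R v))\<^sup>2"
    by (simp add: dist_norm norm_minus_commute algebra_simps)
  then have "h * (2 * (v \<bullet> (q - p))) \<le> h * (h * (v \<bullet> v))"
    unfolding power2_norm_eq_inner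
    by (simp add: inner_diff_left inner_diff_right inner_commute algebra_simps)
  then have "2 * (v \<bullet> (q - p)) \<le> h * (v \<bullet> v)" using h(1) by simp
  then show False using h'(2) pos by linarith
qed

lemma point_add_right:
  assumes "of_int a \<le> t" "t < of_int a + 1" "0 \<le> h" "t + h \<le> of_int a + 1"
  shows "point c (t + h) = point c t + h *\<^sub>R edge_vec c a"
  using assms by (simp add: point_on_edge[of a] algebra_simps)

text \<open>
  The parameter \<open>s\<close> lies on edge \<open>a\<close> and \<open>t\<close> lies on edge \<open>a + k\<close>; endpoints of edges are included
  so that vertices may be attributed to either of the adjacent edges.
\<close>

lemma chord_eq_sum:
  assumes "of_int a \<le> s" "s \<le> of_int a + 1" "of_int (a + int k) \<le> t" "t \<le> of_int (a + int k) + 1"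
  shows "point c t - point c s =
    (\<Sum>i<k. edge_vec c (a + int i)) + (t - of_int (a + int k)) *\<^sub>R edge_vec c (a + int k)
      - (s - of_int a) *\<^sub>R edge_vec c a"
  using assms by (simp add: point_on_edge[of a s] point_on_edge[of "a + int k" t] vertex_add_edges)

lemma chord_eq_weighted_sum:
  assumes "of_int a \<le> s" "s \<le> of_int a + 1" "of_int (a + int k) \<le> t" "t \<le> of_int (a + int k) + 1" "s \<le> t"
  obtains w :: "nat \<Rightarrow> real" where "\<And>i. 0 \<le> w i"
    "point c t - point c s = (\<Sum>i\<le>k. w i *\<^sub>R edge_vec c (a + int i))"
proof (cases k)
  case 0
  then have "point c t - point c s = (\<Sum>i\<le>k. (t - s) *\<^sub>R edge_vec c (a + int i))"
    using assms by (simp add: chord_eq_sum[of a s k t] algebra_simps)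
  then show thesis using that[of "\<lambda>_. t - s"] assms by simp
next
  case (Suc m)
  define w where "w i = (if i = 0 then of_int a + 1 - s
    else if i = k then t - of_int (a + int k) else 1)" for i
  have "(\<Sum>i\<le>k. w i *\<^sub>R edge_vec c (a + int i)) =
      w k *\<^sub>R edge_vec c (a + int k) + (\<Sum>i<k. w i *\<^sub>R edge_vec c (a + int i))"
    by (simp add: lessThan_Suc_atMost[symmetric])
  also have "(\<Sum>i<k. w i *\<^sub>R edge_vec c (a + int i)) =
      w 0 *\<^sub>R edge_vec c a + (\<Sum>i<m. w (Suc i) *\<^sub>R edge_vec c (a + int (Suc i)))"
    unfolding Suc by (subst sum.lessThan_Suc_shift) simp
  also have "(\<Sum>i<m. w (Suc i) *\<^sub>R edge_vec c (a + int (Suc i))) =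
      (\<Sum>i<k. edge_vec c (a + int i)) - edge_vec c a"
    unfolding Suc by (subst sum.lessThan_Suc_shift) (simp add: w_def Suc)
  finally have "point c t - point c s = (\<Sum>i\<le>k. w i *\<^sub>R edge_vec c (a + int i))"
    using assms Suc by (simp add: chord_eq_sum[of a s k t] w_def algebra_simps)
  moreover have "0 \<le> w i" for i using assms by (simp add: w_def)
  ultimately show thesis using that by blast
qed

text \<open>
  At a local minimum the first and the last edge of the arc make angles of at least \<open>pi / 2\<close> with
  the chord, so the arc turns by at least \<open>pi\<close> strictly between its ends. Each vertex
  contributes at most \<open>\<theta>\<close>. If an end of the arc is a vertex, the first or last edge is the one
  that belongs to the arc.
\<close>

lemma dcsd_arc_vertices:
  assumes P: "closed_polygon P" "no_self_intersections P" "c \<in> set P" "equilateral l P" "0 < l"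
    and turn: "\<And>i. turning_angle c i \<le> \<theta>" and \<theta>: "0 < \<theta>" "\<theta> < pi"
    and pq: "(point c s, point c t) \<in> dcsd P" and st: "s < t" "t < s + real (length c)"
  shows "pi / \<theta> \<le> real (card (vertices P \<inter> point c ` {s..t}))"
proof -
  define a where "a = \<lfloor>s\<rfloor>"
  define b where "b = \<lceil>t\<rceil> - 1"
  have a: "of_int a \<le> s" "s < of_int a + 1" by (simp_all add: a_def)
  have b: "of_int b < t" "t \<le> of_int b + 1"
    using le_of_int_ceiling[of t] of_int_ceiling_diff_one_le[of t] ceiling_correct[of t] by (simp_all add: b_def)
  have "of_int a < (of_int b + 1 :: real)" using a b st by linarith
  then have "a \<le> b" by linarith
  define k where "k = nat (b - a)"
  have k: "b = a + int k" using \<open>a \<le> b\<close> by (simp add: k_def)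
  define U where "U i = sgn (edge_vec c (a + int i))" for i
  have len: "norm (edge_vec c i) = l" for i using P(3,4) by (simp add: equilateral_def)
  have edge: "edge_vec c (a + int i) = l *\<^sub>R U i" for i
    using len[of "a + int i"] P(5) by (simp add: U_def sgn_div_norm)
  have unit: "norm (U i) = 1" for i
    using len[of "a + int i"] P(5) by (auto simp: U_def norm_sgn)
  have turnU: "arccos (U i \<bullet> U (Suc i)) \<le> \<theta>" for i
    using turn[of "a + int i + 1"] by (simp add: U_def turning_angle_def add_ac)
  define w where "w = point c t - point c s"
  have "w \<noteq> 0" using pq by (auto simp: w_def dcsd_def)
  obtain x where x: "\<And>i. 0 \<le> x i" "w = (\<Sum>i\<le>k. x i *\<^sub>R edge_vec c (a + int i))"
    unfolding w_def using chord_eq_weighted_sum[of a s k t c] a b st k by auto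
  have in_trace: "point c r \<in> trace P" for r
    using P(3) by (auto simp: trace_def trace_comp_def)
  have start: "edge_vec c a \<bullet> w \<le> 0"
    unfolding w_def
  proof (rule dcsd_first_variation[OF pq, of "of_int a + 1 - s"])
    fix h assume "0 < h" "h < of_int a + 1 - s"
    then have "point c s + h *\<^sub>R edge_vec c a = point c (s + h)"
      using a by (intro point_add_right[symmetric]) auto
    then show "point c s + h *\<^sub>R edge_vec c a \<in> trace P" using in_trace by simp
  qed (use a in simp)
  have "(- edge_vec c b) \<bullet> (point c s - point c t) \<le> 0"
  proof (rule dcsd_first_variation[OF dcsd_sym[OF pq], of "t - of_int b"])
    fix h assume "0 < h" "h < t - of_int b"
    then have "point c ((t - h) + h) = point c (t - h) + h *\<^sub>R edge_vec c b"
      using b by (intro point_add_right) auto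
    then have "point c t + h *\<^sub>R (- edge_vec c b) = point c (t - h)" by simp
    then show "point c t + h *\<^sub>R (- edge_vec c b) \<in> trace P" using in_trace by simp
  qed (use b in simp)
  then have finish: "edge_vec c b \<bullet> w \<le> 0"
    unfolding w_def by (simp add: inner_diff_right)
  have "pi \<le> real k * \<theta>"
  proof (rule turning_at_least_pi[of U \<theta> w "\<lambda>i. x i * l" k])
    show "w = (\<Sum>i\<le>k. (x i * l) *\<^sub>R U i)" unfolding x(2) by (simp add: edge)
    show "U 0 \<bullet> w \<le> 0" "U k \<bullet> w \<le> 0"
      using start finish P(5) unfolding k U_def by (simp_all add: len sgn_div_norm mult_nonneg_nonpos)
    show "0 \<le> x i * l" for i using x(1) P(5) by simp
  qed (use unit turnU \<theta> \<open>w \<noteq> 0\<close> in auto)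
  then have "pi / \<theta> \<le> real k" using \<theta> by (simp add: field_simps)
  also have "real k \<le> real (nat (\<lfloor>t\<rfloor> - \<lceil>s\<rceil> + 1))"
  proof -
    have "\<lceil>s\<rceil> \<le> a + 1" using a by (simp add: ceiling_le_iff)
    moreover have "b \<le> \<lfloor>t\<rfloor>" using b by (simp add: le_floor_iff)
    ultimately show ?thesis unfolding k_def by linarith
  qed
  also have "\<dots> = real (card (vertices P \<inter> point c ` {s..t}))"
    using vertices_on_arc(2)[OF P(1,2,3), of s t] st by simp
  finally show ?thesis .
qed

text \<open>
  On one component the bound holds for each of the two arcs joining the points; between different
  components \<open>vb\<close> is infinite.
\<close>

lemma dcsd_subset_VB:
  assumes P: "closed_polygon P" "no_self_intersections P" "equilateral l P" "0 < l"
    and turn: "\<And>c i. c \<in> set P \<Longrightarrow> turning_angle c i \<le> theta \<tau> l" and \<theta>: "0 < theta \<tau> l" "theta \<tau> l < pi"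
  shows "dcsd P \<subseteq> VB P \<tau> l"
proof clarify
  fix p q assume pq: "(p, q) \<in> dcsd P"
  have "ereal (pi / theta \<tau> l) \<le> ereal (real (card (vertices P \<inter> A)))"
    if "A \<in> arcs_joining P p q" for A
  proof -
    from that obtain c s t where A: "A = point c ` {s..t}" "c \<in> set P" "s \<le> t" "t \<le> s + real (length c)"
      and ends: "point c s = p \<and> point c t = q \<or> point c s = q \<and> point c t = p"
      by (auto simp: arcs_joining_def)
    have st: "(point c s, point c t) \<in> dcsd P" using ends pq dcsd_sym by auto
    then have "point c s \<noteq> point c t" by (simp add: dcsd_def)
    then have "s \<noteq> t" "t \<noteq> s + real (length c)" using point_shift_once[of c s] by auto
    then show ?thesis
      unfolding A(1) using A(2-4) dcsd_arc_vertices[OF P(1,2) A(2) P(3,4) turn[OF A(2)] \<theta> st] by simp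
  qed
  then have "ereal (pi / theta \<tau> l) \<le> vb P p q"
    by (auto simp: vb_def intro: INF_greatest)
  then show "(p, q) \<in> VB P \<tau> l" using pq by (simp add: VB_def dcsd_def)
qed


section \<open>Pairs that are far apart along the polygon\<close>

text \<open>
  The case \<open>\<phi> = pi\<close> has to be excluded separately: there \<open>tan (\<phi> / 2)\<close> has the default value 0,
  and so has \<open>MinRad\<close>, contrary to the assumption.
\<close>

lemma turning_angle_le_theta:
  assumes P: "closed_polygon P" "equilateral l P" "0 < l" "c \<in> set P"
    and minrad: "1 \<le> min_MinRad P"
  shows "turning_angle c i \<le> theta 1 l"
proof (cases "turning_angle c i = 0")
  case True
  then show ?thesis using P(3) by (simp add: theta_def)
next
  case False
  define n where "n = int (length c)"
  define j where "j = i mod n"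
  define \<phi> where "\<phi> = turning_angle c j"
  have \<phi>: "turning_angle c i = \<phi>" by (simp add: \<phi>_def j_def n_def turning_angle_mod)
  have "0 < n" using closed_polygon_nonempty[OF P(1,4)] by (simp add: n_def)
  then have "0 \<le> j" "j < int (length c)" by (simp_all add: j_def n_def[symmetric])
  then have "min_MinRad P \<le> ereal (MinRad c j)"
    unfolding min_MinRad_def using P(4) False \<phi> \<phi>_def by (intro Inf_lower) auto
  then have "1 \<le> MinRad c j" using minrad order_trans by fastforce
  moreover have len: "norm (edge_vec c i) = l" for i using P(2,4) by (simp add: equilateral_def)
  ultimately have quot: "1 \<le> l / (2 * tan (\<phi> / 2))"
    by (simp add: MinRad_def MinRad_minus_def MinRad_plus_def \<phi>_def)
  have unit: "norm (sgn (edge_vec c i)) = 1" for i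
    using len[of i] P(3) by (auto simp: norm_sgn)
  have "0 \<le> \<phi>" "\<phi> \<le> pi"
    unfolding \<phi>_def turning_angle_def
    using arccos_inner_bounds[OF unit unit] by (auto intro: arccos_lbound arccos_ubound)
  have t: "0 < tan (\<phi> / 2)"
  proof (rule ccontr)
    assume "\<not> 0 < tan (\<phi> / 2)"
    then have "l / (2 * tan (\<phi> / 2)) \<le> 0" using P(3) by (intro divide_nonneg_nonpos) auto
    then show False using quot by linarith
  qed
  then have t': "tan (\<phi> / 2) \<le> l / 2" using quot by (simp add: field_simps)
  have "\<phi> \<noteq> pi" using t by auto
  then have "\<phi> / 2 = arctan (tan (\<phi> / 2))"
    using \<open>0 \<le> \<phi>\<close> \<open>\<phi> \<le> pi\<close> by (intro arctan_tan[symmetric]) auto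
  also have "\<dots> \<le> arctan (l / 2)" using t' by (simp add: arctan_le_iff)
  finally show ?thesis by (simp add: \<phi> theta_def)
qed

text \<open>
  Two symmetric forms of the comparison with the circumscribed planar arc, for an arc that starts at a
  vertex and for an arc that ends at one. The other end of the arc lies on the edge that is reached
  after \<open>k\<close> full edges.
\<close>

lemma chord_from_vertex_ge_2:
  assumes P: "equilateral l P" "0 < l" "c \<in> set P"
    and turn: "\<And>i. turning_angle c i \<le> theta 1 l"
    and k: "real k * theta 1 l < pi" "pi \<le> real (Suc k) * theta 1 l"
    and t: "of_int (a + int k) \<le> t" "t \<le> of_int (a + int k) + 1"
  shows "2 \<le> dist (point c (of_int a)) (point c t)"
proof -
  define U where "U i = sgn (edge_vec c (a + int i))" for i
  have len: "norm (edge_vec c i) = l" for i using P(1,3) by (simp add: equilateral_def)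
  have edge: "edge_vec c (a + int i) = l *\<^sub>R U i" for i
    using len[of "a + int i"] P(2) by (simp add: U_def sgn_div_norm)
  have unit: "norm (U i) = 1" for i
    using len[of "a + int i"] P(2) by (auto simp: U_def norm_sgn)
  have turnU: "arccos (U i \<bullet> U (Suc i)) \<le> theta 1 l" for i
    using turn[of "a + int i + 1"] by (simp add: U_def turning_angle_def add_ac)
  have \<theta>: "0 < theta 1 l" "theta 1 l < pi" "2 * tan (theta 1 l / 2) = l"
    using P(2) arctan_ubound[of "l / 2"] by (simp_all add: theta_def tan_arctan)
  have "2 \<le> norm ((\<Sum>i<k. (2 * tan (theta 1 l / 2)) *\<^sub>R U i) + ((t - of_int (a + int k)) * l) *\<^sub>R U k)"
    using t P(2) by (intro bounded_turning_chord_ge_2 unit turnU \<theta> k) auto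
  also have "(\<Sum>i<k. (2 * tan (theta 1 l / 2)) *\<^sub>R U i) + ((t - of_int (a + int k)) * l) *\<^sub>R U k
      = point c t - point c (of_int a)"
    using t by (simp add: chord_eq_sum[of a "of_int a" k t] edge \<theta>(3))
  finally show ?thesis by (simp add: dist_norm norm_minus_commute)
qed

lemma chord_to_vertex_ge_2:
  assumes P: "equilateral l P" "0 < l" "c \<in> set P"
    and turn: "\<And>i. turning_angle c i \<le> theta 1 l"
    and k: "real k * theta 1 l < pi" "pi \<le> real (Suc k) * theta 1 l"
    and s: "of_int (b - int k) - 1 \<le> s" "s \<le> of_int (b - int k)"
  shows "2 \<le> dist (point c s) (point c (of_int b))"
proof -
  define a where "a = b - 1 - int k"
  define U where "U i = sgn (edge_vec c (b - 1 - int i))" for i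
  have len: "norm (edge_vec c i) = l" for i using P(1,3) by (simp add: equilateral_def)
  have edge: "edge_vec c (b - 1 - int i) = l *\<^sub>R U i" for i
    using len[of "b - 1 - int i"] P(2) by (simp add: U_def sgn_div_norm)
  have unit: "norm (U i) = 1" for i
    using len[of "b - 1 - int i"] P(2) by (auto simp: U_def norm_sgn)
  have turnU: "arccos (U i \<bullet> U (Suc i)) \<le> theta 1 l" for i
    using turn[of "b - 1 - int i"] by (simp add: U_def turning_angle_def inner_commute diff_diff_eq add_ac)
  have \<theta>: "0 < theta 1 l" "theta 1 l < pi" "2 * tan (theta 1 l / 2) = l"
    using P(2) arctan_ubound[of "l / 2"] by (simp_all add: theta_def tan_arctan)
  have "2 \<le> norm ((\<Sum>i<k. (2 * tan (theta 1 l / 2)) *\<^sub>R U i) + ((of_int (b - int k) - s) * l) *\<^sub>R U k)"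
    using s P(2) by (intro bounded_turning_chord_ge_2 unit turnU \<theta> k) auto
  also have "(\<Sum>i<k. (2 * tan (theta 1 l / 2)) *\<^sub>R U i) + ((of_int (b - int k) - s) * l) *\<^sub>R U k
      = (\<Sum>i<k. edge_vec c (b - 1 - int i)) + (of_int (b - int k) - s) *\<^sub>R edge_vec c a"
    by (simp add: edge \<theta>(3) a_def)
  also have "\<dots> = (\<Sum>i<Suc k. edge_vec c (b - 1 - int i)) - (s - of_int a) *\<^sub>R edge_vec c a"
    by (simp add: a_def algebra_simps)
  also have "(\<Sum>i<Suc k. edge_vec c (b - 1 - int i)) = (\<Sum>i<Suc k. edge_vec c (a + int (Suc k - Suc i)))"
    by (intro sum.cong) (auto simp: a_def of_nat_diff algebra_simps)
  also have "\<dots> = (\<Sum>i<Suc k. edge_vec c (a + int i))"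
    by (rule sum.nat_diff_reindex)
  also have "\<dots> - (s - of_int a) *\<^sub>R edge_vec c a = point c (of_int b) - point c s"
    using s by (subst chord_eq_sum[of a s k "of_int b"]) (auto simp: a_def)
  finally show ?thesis by (simp add: dist_norm norm_minus_commute)
qed

text \<open>
  The arc with parameters in \<open>{s..t}\<close> contains \<open>k\<close> full consecutive edges, that is, at least
  \<open>k + 1\<close> vertices. Below, \<open>k + 1\<close> is the least integer that is at least \<open>pi / theta 1 l\<close>. The
  existential form exhibits the condition as a closed one, and as stable under small changes of
  \<open>s\<close> and \<open>t\<close> when both inequalities are strict.
\<close>

definition spans_edges :: "nat \<Rightarrow> real \<Rightarrow> real \<Rightarrow> bool" where
  "spans_edges k s t \<longleftrightarrow> (\<exists>i::int. s \<le> of_int i \<and> of_int i + real k \<le> t)"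

lemma spans_edges_iff: "spans_edges k s t \<longleftrightarrow> int k \<le> \<lfloor>t\<rfloor> - \<lceil>s\<rceil>"
proof
  assume "spans_edges k s t"
  then obtain i :: int where "s \<le> of_int i" "of_int (i + int k) \<le> t"
    by (auto simp: spans_edges_def)
  then have "\<lceil>s\<rceil> \<le> i" "i + int k \<le> \<lfloor>t\<rfloor>" by (simp_all only: ceiling_le_iff le_floor_iff)
  then show "int k \<le> \<lfloor>t\<rfloor> - \<lceil>s\<rceil>" by linarith
next
  assume "int k \<le> \<lfloor>t\<rfloor> - \<lceil>s\<rceil>"
  then have "of_int (\<lceil>s\<rceil> + int k) \<le> t" by (simp only: le_floor_iff[symmetric])
  then show "spans_edges k s t"
    unfolding spans_edges_def by (intro exI[of _ "\<lceil>s\<rceil>"]) auto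
qed

lemma spans_edges_shift:
  assumes "spans_edges k s t"
  shows "spans_edges k (s + of_int j * real n) (t + of_int j * real n)"
proof -
  obtain i :: int where "s \<le> of_int i" "of_int i + real k \<le> t"
    using assms by (auto simp: spans_edges_def)
  then show ?thesis
    unfolding spans_edges_def by (intro exI[of _ "i + j * int n"]) auto
qed

text \<open>
  The condition can only be destroyed by a small motion of the ends if an end that is a vertex is
  moved into the arc, and no more than one edge beyond the \<open>k\<close> full ones is available. The two
  boundary cases are the hypotheses of the two chord estimates above.
\<close>

lemma spans_edges_stable_or_boundary:
  assumes "spans_edges k s t"
  obtains (stable) e where "0 < e" "\<And>s' t'. \<bar>s' - s\<bar> < e \<Longrightarrow> \<bar>t' - t\<bar> < e \<Longrightarrow> spans_edges k s' t'"
    | (start) a :: int where "s = of_int a" "of_int (a + int k) \<le> t" "t \<le> of_int (a + int k) + 1"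
    | (finish) b :: int where "t = of_int b" "of_int (b - int k) - 1 \<le> s" "s \<le> of_int (b - int k)"
proof (cases "\<exists>i::int. s < of_int i \<and> of_int i + real k < t")
  case True
  then obtain i :: int where i: "s < of_int i" "of_int i + real k < t" by blast
  show thesis
  proof (rule stable[of "min (of_int i - s) (t - (of_int i + real k))"])
    fix s' t' assume "\<bar>s' - s\<bar> < min (of_int i - s) (t - (of_int i + real k))"
      "\<bar>t' - t\<bar> < min (of_int i - s) (t - (of_int i + real k))"
    then show "spans_edges k s' t'"
      unfolding spans_edges_def by (intro exI[of _ i]) auto
  qed (use i in auto)
next
  case False
  obtain i :: int where i: "s \<le> of_int i" "of_int i + real k \<le> t"
    using assms by (auto simp: spans_edges_def)
  then consider "s = of_int i" | "s < of_int i" "t = of_int (i + int k)"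
    using False by (cases "s = of_int i") (auto simp: not_less intro: antisym)
  then show thesis
  proof cases
    case 1
    have "\<not> of_int (i + 1) + real k < t" using False 1 by (metis less_add_one of_int_less_iff)
    then show thesis using 1 i by (intro start[of i]) auto
  next
    case 2
    have "\<not> (s < of_int (i - 1) \<and> of_int (i - 1) + real k < t)" using False by blast
    then have "\<not> s < of_int (i - 1)" using 2 by simp
    then show thesis using 2 by (intro finish[of "i + int k"]) auto
  qed
qed

text \<open>
  The far pairs are closed under limits and invariant under translation of both parameters by a
  period, so the distance attains its minimum on them.
\<close>

lemma closest_far_pair:
  assumes "c \<noteq> []" and far: "spans_edges k s t" "spans_edges k t (s + real (length c))"
  obtains s0 t0 where "spans_edges k s0 t0" "spans_edges k t0 (s0 + real (length c))"
    "\<And>s' t'. spans_edges k s' t' \<Longrightarrow> spans_edges k t' (s' + real (length c)) \<Longrightarrow>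
      dist (point c s0) (point c t0) \<le> dist (point c s') (point c t')"
proof -
  define n where "n = real (length c)"
  define K where "K = {z \<in> {0..n} \<times> {0..2 * n}.
    spans_edges k (fst z) (snd z) \<and> spans_edges k (snd z) (fst z + n)}"
  define I where "I = {0..2 * int (length c)}"
  have K_eq: "K = ({0..n} \<times> {0..2 * n}) \<inter>
     (\<Union>i\<in>I. {z. fst z \<le> of_int i} \<inter> {z. of_int i + real k \<le> snd z}) \<inter>
     (\<Union>i\<in>I. {z. snd z \<le> of_int i} \<inter> {z. of_int i + real k \<le> fst z + n})" (is "K = ?R")
  proof
    show "?R \<subseteq> K" by (auto simp: K_def spans_edges_def)
    show "K \<subseteq> ?R"
    proof
      fix z assume z: "z \<in> K"
      then obtain i j :: int where i: "fst z \<le> of_int i" "of_int i + real k \<le> snd z"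
        and j: "snd z \<le> of_int j" "of_int j + real k \<le> fst z + n"
        by (auto simp: K_def spans_edges_def)
      have zb: "0 \<le> fst z" "fst z \<le> n" "0 \<le> snd z" "snd z \<le> 2 * n" using z by (auto simp: K_def)
      have "(0::real) \<le> of_int i" "of_int i \<le> 2 * n" "(0::real) \<le> of_int j" "of_int j \<le> 2 * n"
        using i j zb by linarith+
      then have "i \<in> I" "j \<in> I" unfolding I_def n_def by auto
      then show "z \<in> ?R" using i j zb by (auto simp: mem_Times_iff)
    qed
  qed
  have "closed (\<Union>i\<in>I. {z. fst z \<le> of_int i} \<inter> {z :: real \<times> real. of_int i + real k \<le> snd z})"
    "closed (\<Union>i\<in>I. {z. snd z \<le> of_int i} \<inter> {z :: real \<times> real. of_int i + real k \<le> fst z + n})"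
    unfolding I_def
    by (intro closed_UN ballI closed_Int closed_Collect_le continuous_intros finite_atLeastAtMost_int)+
  then have "compact K"
    unfolding K_eq by (intro compact_Int_closed compact_Times compact_Icc)
  moreover have to_K: "\<exists>z\<in>K. point c (fst z) = point c s' \<and> point c (snd z) = point c t'"
    if st: "spans_edges k s' t'" "spans_edges k t' (s' + n)" for s' t'
  proof -
    obtain j :: int where j: "0 \<le> s' + of_int j * n" "s' + of_int j * n < 0 + n"
      using ex_shift_into_period[OF assms(1), of 0 s'] unfolding n_def by blast
    define z where "z = (s' + of_int j * n, t' + of_int j * n)"
    have "s' \<le> t'" "t' \<le> s' + n" using st by (auto simp: spans_edges_def)
    moreover have "s' + n + of_int j * n = s' + of_int j * n + n" by simp
    ultimately have "z \<in> K"
      unfolding K_def z_def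
      using j spans_edges_shift[OF st(1), of j "length c"] spans_edges_shift[OF st(2), of j "length c"]
      by (auto simp: n_def[symmetric] add_ac)
    then show ?thesis by (intro bexI[of _ z]) (simp_all add: z_def n_def point_shift)
  qed
  then have "K \<noteq> {}" using far by (auto simp: n_def)
  moreover have "continuous_on K (\<lambda>z. dist (point c (fst z)) (point c (snd z)))"
    by (intro continuous_intros continuous_on_compose2[OF continuous_on_point[of UNIV]]) auto
  ultimately obtain z0 where z0: "z0 \<in> K"
    "\<And>z. z \<in> K \<Longrightarrow> dist (point c (fst z0)) (point c (snd z0)) \<le> dist (point c (fst z)) (point c (snd z))"
    using continuous_attains_inf[of K "\<lambda>z. dist (point c (fst z)) (point c (snd z))"] by blast
  show thesis
  proof (rule that[of "fst z0" "snd z0"])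
    fix s' t' assume "spans_edges k s' t'" "spans_edges k t' (s' + real (length c))"
    then obtain z where "z \<in> K" "point c (fst z) = point c s'" "point c (snd z) = point c t'"
      using to_K unfolding n_def by blast
    then show "dist (point c (fst z0)) (point c (snd z0)) \<le> dist (point c s') (point c t')"
      using z0(2)[of z] by simp
  qed (use z0(1) in \<open>auto simp: K_def n_def\<close>)
qed

text \<open>
  Take a closest far pair. Either all nearby pairs are far too, and the pair is a local minimum of
  the distance on the whole polygon, or it lies on the boundary of the set of far pairs, and one of
  its two arcs is subject to the comparison with the circumscribed planar arc.
\<close>

lemma far_pair_dist_ge_2:
  assumes P: "closed_polygon P" "no_self_intersections P" "equilateral l P" "0 < l" "c \<in> set P"
    and turn: "\<And>i. turning_angle c i \<le> theta 1 l"
    and dcsd: "\<And>p q. (p, q) \<in> dcsd P \<Longrightarrow> 2 \<le> dist p q"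
    and k: "0 < k" "real k * theta 1 l < pi" "pi \<le> real (Suc k) * theta 1 l"
    and far: "spans_edges k s t" "spans_edges k t (s + real (length c))"
  shows "2 \<le> dist (point c s) (point c t)"
proof -
  note ne = closed_polygon_nonempty[OF P(1,5)] and inj = no_self_intersections_inj[OF P(2,5)]
  note from_vertex = chord_from_vertex_ge_2[OF P(3,4,5) turn k(2,3)]
    and to_vertex = chord_to_vertex_ge_2[OF P(3,4,5) turn k(2,3)]
  obtain s0 t0 where far0: "spans_edges k s0 t0" "spans_edges k t0 (s0 + real (length c))"
    and closest: "\<And>s' t'. spans_edges k s' t' \<Longrightarrow> spans_edges k t' (s' + real (length c)) \<Longrightarrow>
      dist (point c s0) (point c t0) \<le> dist (point c s') (point c t')"
    using closest_far_pair[OF ne far] by blast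
  have "2 \<le> dist (point c s0) (point c t0)"
    using far0(1)
  proof (cases rule: spans_edges_stable_or_boundary)
    case (start a)
    then show ?thesis using from_vertex by simp
  next
    case (finish b)
    then show ?thesis using to_vertex by simp
  next
    case (stable e1)
    note stable1 = stable
    show ?thesis
      using far0(2)
    proof (cases rule: spans_edges_stable_or_boundary)
      case (start a)
      then have "2 \<le> dist (point c t0) (point c (s0 + real (length c)))" using from_vertex by simp
      then show ?thesis by (simp add: point_shift_once dist_commute)
    next
      case (finish b)
      then have "2 \<le> dist (point c t0) (point c (s0 + real (length c)))" using to_vertex by simp
      then show ?thesis by (simp add: point_shift_once dist_commute)
    next
      case (stable e2)
      define e where "e = min e1 e2"
      have "0 < e" using stable stable1 by (simp add: e_def)
      obtain d1 where d1: "0 < d1" "\<And>p. p \<in> trace P \<Longrightarrow> dist p (point c s0) < d1 \<Longrightarrow>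
          \<exists>s'. \<bar>s' - s0\<bar> < e \<and> point c s' = p"
        using nearby_points_have_nearby_parameters[OF P(1,2,5) \<open>0 < e\<close>] by blast
      obtain d2 where d2: "0 < d2" "\<And>p. p \<in> trace P \<Longrightarrow> dist p (point c t0) < d2 \<Longrightarrow>
          \<exists>t'. \<bar>t' - t0\<bar> < e \<and> point c t' = p"
        using nearby_points_have_nearby_parameters[OF P(1,2,5) \<open>0 < e\<close>] by blast
      have "(point c s0, point c t0) \<in> dcsd P"
      proof (rule dcsdI[of _ P _ "min d1 d2"])
        show "point c s0 \<in> trace P" "point c t0 \<in> trace P"
          using P(5) by (auto simp: trace_def trace_comp_def)
        have "s0 < t0" "t0 < s0 + real (length c)"
          using far0 k(1) by (auto simp: spans_edges_def)
        then show "point c s0 \<noteq> point c t0"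
          using inj_on_point_period[OF inj ne, of s0 t0] by auto
      next
        fix p q assume "p \<in> trace P" "q \<in> trace P" "dist p (point c s0) < min d1 d2"
          "dist q (point c t0) < min d1 d2"
        then obtain s' t' where st: "\<bar>s' - s0\<bar> < e" "point c s' = p" "\<bar>t' - t0\<bar> < e" "point c t' = q"
          using d1(2) d2(2) by (meson min_less_iff_conj)
        then have "spans_edges k s' t'" "spans_edges k t' (s' + real (length c))"
          using stable1(2)[of s' t'] stable(2)[of t' "s' + real (length c)"] by (auto simp: e_def)
        then show "dist (point c s0) (point c t0) \<le> dist p q" using closest st by blast
      qed (use d1(1) d2(1) in simp)
      then show ?thesis by (rule dcsd)
    qed
  qed
  also have "\<dots> \<le> dist (point c s) (point c t)" using closest far .
  finally show ?thesis .
qed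

text \<open>
  A closest pair of points on the two components is a local minimum of the distance on the whole
  polygon, since near each point the polygon consists of its own component only.
\<close>

lemma different_components_dist_ge_2:
  assumes P: "closed_polygon P" "no_self_intersections P" "c \<in> set P" "c' \<in> set P" "c \<noteq> c'"
    and dcsd: "\<And>p q. (p, q) \<in> dcsd P \<Longrightarrow> 2 \<le> dist p q"
    and pq: "p \<in> trace_comp c" "q \<in> trace_comp c'"
  shows "2 \<le> dist p q"
proof -
  have "compact (trace_comp c \<times> trace_comp c')"
    using closed_polygon_nonempty[OF P(1)] P(3,4) by (intro compact_Times compact_trace_comp) auto
  moreover have "continuous_on (trace_comp c \<times> trace_comp c') (\<lambda>z. dist (fst z) (snd z))"
    by (intro continuous_intros)
  moreover have "trace_comp c \<times> trace_comp c' \<noteq> {}" using pq by blast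
  ultimately obtain z where z: "z \<in> trace_comp c \<times> trace_comp c'"
    "\<And>w. w \<in> trace_comp c \<times> trace_comp c' \<Longrightarrow> dist (fst z) (snd z) \<le> dist (fst w) (snd w)"
    using continuous_attains_inf[of "trace_comp c \<times> trace_comp c'" "\<lambda>z. dist (fst z) (snd z)"]
    by blast
  obtain s t where st: "fst z = point c s" "snd z = point c' t"
    using z(1) by (auto simp: trace_comp_def)
  obtain d1 where d1: "0 < d1" "\<And>p. p \<in> trace P \<Longrightarrow> dist p (point c s) < d1 \<Longrightarrow>
      \<exists>s'. \<bar>s' - s\<bar> < 1 \<and> point c s' = p"
    using nearby_points_have_nearby_parameters[OF P(1,2,3) zero_less_one] by blast
  obtain d2 where d2: "0 < d2" "\<And>p. p \<in> trace P \<Longrightarrow> dist p (point c' t) < d2 \<Longrightarrow>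
      \<exists>t'. \<bar>t' - t\<bar> < 1 \<and> point c' t' = p"
    using nearby_points_have_nearby_parameters[OF P(1,2,4) zero_less_one] by blast
  have "(fst z, snd z) \<in> dcsd P"
  proof (rule dcsdI[of _ P _ "min d1 d2"])
    show "fst z \<in> trace P" "snd z \<in> trace P" using z(1) P(3,4) by (auto simp: trace_def)
    show "fst z \<noteq> snd z"
    proof
      assume "fst z = snd z"
      then have "fst z \<in> trace_comp c \<inter> trace_comp c'" using z(1) by (simp add: mem_Times_iff)
      then show False using components_disjoint[OF P(2-5)] by blast
    qed
  next
    fix p q assume "p \<in> trace P" "q \<in> trace P" "dist p (fst z) < min d1 d2" "dist q (snd z) < min d1 d2"
    then obtain s' t' where "point c s' = p" "point c' t' = q"
      using d1(2)[of p] d2(2)[of q] st by (metis min_less_iff_conj)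
    then have "p \<in> trace_comp c" "q \<in> trace_comp c'"
      by (auto simp: trace_comp_def)
    then show "dist (fst z) (snd z) \<le> dist p q" using z(2)[of "(p, q)"] by simp
  qed (use d1(1) d2(1) in simp)
  then have "2 \<le> dist (fst z) (snd z)" by (rule dcsd)
  also have "\<dots> \<le> dist p q" using z(2)[of "(p, q)"] pq by simp
  finally show ?thesis .
qed

lemma arcs_joining_sub_arc:
  assumes "c \<in> set P" "s \<le> t" "t \<le> s + real (length c)"
  shows "point c ` {s..t} \<in> arcs_joining P (point c s) (point c t)"
    and "point c ` {s..t} \<in> arcs_joining P (point c t) (point c s)"
  unfolding arcs_joining_def using assms by blast+

text \<open>
  Turns the vertex counts in the definition of \<open>vb\<close> into the condition \<open>spans_edges\<close> for the two
  complementary arcs. Here \<open>1 < pi / theta 1 l\<close> matters: it makes \<open>k\<close> positive, which excludes a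
  pair of equal points, joined by an arc with at most one vertex.
\<close>

lemma VB_dist_ge_2:
  assumes P: "closed_polygon P" "no_self_intersections P" "equilateral l P" "0 < l"
    and turn: "\<And>c i. c \<in> set P \<Longrightarrow> turning_angle c i \<le> theta 1 l"
    and dcsd: "\<And>p q. (p, q) \<in> dcsd P \<Longrightarrow> 2 \<le> dist p q"
    and pq: "(p, q) \<in> VB P 1 l"
  shows "2 \<le> dist p q"
proof (cases "\<exists>c\<in>set P. p \<in> trace_comp c \<and> q \<in> trace_comp c")
  case False
  obtain c c' where c: "c \<in> set P" "c' \<in> set P" "p \<in> trace_comp c" "q \<in> trace_comp c'"
    using pq by (auto simp: VB_def trace_def)
  then have "c \<noteq> c'" using False by blast
  then show ?thesis
    by (rule different_components_dist_ge_2[OF P(1,2) c(1,2) _ dcsd c(3,4)])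
next
  case True
  then obtain c where c: "c \<in> set P" "p \<in> trace_comp c" "q \<in> trace_comp c" by blast
  note ne = closed_polygon_nonempty[OF P(1) c(1)]
  define \<theta> where "\<theta> = theta 1 l"
  have \<theta>: "0 < \<theta>" "\<theta> < pi"
    using P(4) arctan_ubound[of "l / 2"] by (simp_all add: \<theta>_def theta_def)
  define k where "k = nat (\<lceil>pi / \<theta>\<rceil> - 1)"
  have "1 < pi / \<theta>" using \<theta> by simp
  then have "1 < \<lceil>pi / \<theta>\<rceil>" by (simp add: less_ceiling_iff)
  then have "0 < k" "real k = of_int \<lceil>pi / \<theta>\<rceil> - 1" by (simp_all add: k_def)
  moreover have "of_int \<lceil>pi / \<theta>\<rceil> - 1 < pi / \<theta>" "pi / \<theta> \<le> of_int \<lceil>pi / \<theta>\<rceil>"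
    using ceiling_correct[of "pi / \<theta>"] by auto
  ultimately have k: "0 < k" "real k < pi / \<theta>" "pi / \<theta> \<le> real (Suc k)" by simp_all
  obtain s where s: "point c s = p" using c(2) by (auto simp: trace_comp_def)
  obtain t where t: "s \<le> t" "t < s + real (length c)" "point c t = q"
    using trace_comp_period[OF ne c(3), of s] by blast
  have vb: "pi / \<theta> \<le> real (card (vertices P \<inter> A))" if "A \<in> arcs_joining P p q" for A
  proof -
    have "ereal (pi / \<theta>) \<le> vb P p q" using pq by (simp add: VB_def \<theta>_def)
    also have "\<dots> \<le> ereal (real (card (vertices P \<inter> A)))"
      using True that by (auto simp: vb_def intro: INF_lower)
    finally show ?thesis by simp
  qed
  have spans: "spans_edges k a b" if "a \<le> b" "b < a + real (length c)"
    "point c ` {a..b} \<in> arcs_joining P p q" for a b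
  proof -
    have "real k < real (nat (\<lfloor>b\<rfloor> - \<lceil>a\<rceil> + 1))"
      using vb[OF that(3)] k(2) vertices_on_arc(2)[OF P(1,2) c(1) that(1,2)] by simp
    then show ?thesis unfolding spans_edges_iff by linarith
  qed
  have far1: "spans_edges k s t"
    using t s arcs_joining_sub_arc[OF c(1), of s t] by (intro spans) auto
  then have "s < t" using k(1) by (auto simp: spans_edges_def)
  have "point c ` {t..s + real (length c)} \<in> arcs_joining P p q"
    using arcs_joining_sub_arc(2)[OF c(1), of t "s + real (length c)"] s t \<open>s < t\<close>
    by (simp add: point_shift_once)
  then have far2: "spans_edges k t (s + real (length c))"
    using t \<open>s < t\<close> by (intro spans) auto
  have "real k * \<theta> < pi" "pi \<le> real (Suc k) * \<theta>"
    using k(2,3) \<theta> by (simp_all add: field_simps)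
  then have "2 \<le> dist (point c s) (point c t)"
    using far_pair_dist_ge_2[OF P c(1) turn[OF c(1)] dcsd k(1) _ _ far1 far2] by (simp add: \<theta>_def)
  then show ?thesis using s t by simp
qed

theorem theorem2p6:
  fixes l :: real and P :: polygon
  assumes "l > 0"
    and "closed_polygon P"
    and "no_self_intersections P"
    and "equilateral l P"
  shows "Thi_p P \<ge> 1 \<longleftrightarrow> CThi l P \<ge> 1"
proof -
  have half: "1 \<le> ereal (x / 2) \<longleftrightarrow> 2 \<le> x" for x
    by (simp add: one_ereal_def)
  have "(\<forall>(p, q)\<in>dcsd P. 2 \<le> dist p q) \<longleftrightarrow> (\<forall>(p, q)\<in>VB P 1 l. 2 \<le> dist p q)"
    if minrad: "1 \<le> min_MinRad P"
  proof -
    have turn: "turning_angle c i \<le> theta 1 l" if "c \<in> set P" for c i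
      using turning_angle_le_theta[OF assms(2,4,1) that minrad] .
    have \<theta>: "0 < theta 1 l" "theta 1 l < pi"
      using assms(1) arctan_ubound[of "l / 2"] by (simp_all add: theta_def)
    have "dcsd P \<subseteq> VB P 1 l"
      using dcsd_subset_VB[OF assms(2,3,4,1) turn \<theta>] .
    moreover have "2 \<le> dist p q" if "\<forall>(p, q)\<in>dcsd P. 2 \<le> dist p q" "(p, q) \<in> VB P 1 l" for p q
      using VB_dist_ge_2[OF assms(2,3,4,1) turn _ that(2)] that(1) by blast
    ultimately show ?thesis by blast
  qed
  then show ?thesis
    by (auto simp: Thi_p_def CThi_def le_INF_iff half split_beta)
qed

end
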